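(* Fix an arbitrary assignment of polarity (positive or negative) to every atomic formula. For every finite multiset $\Gamma$ of LKF formulas, the sequent $\vdash[\,],\Gamma$ is provable in LKF if and only if the disjunction of the formulas in $\Gamma$ is valid in (first-order) classical logic, where $\wedge^{+},\wedge^{-}$ are read as classical conjunction, $\vee^{+},\vee^{-}$ as classical disjunction, $\supset^{+},\supset^{-}$ as classical implication, $\neg$ as classical negation, $\mathcal T$ and $\neg\mathcal F$ as truth, and $\mathcal F$ and $\neg\mathcal T$ as falsity. That is, LKF is sound and complete with respect to classical logic.
   Context: LKF formulas are first-order formulas in negation normal form built from literals (an atom $A$ or its negation $\neg A$), the constants $\mathcal T,\mathcal F,\neg\mathcal T,\neg\mathcal F$, the connectives $\wedge^{+},\wedge^{-},\vee^{+},\vee^{-}$, and quantifiers $\forall,\exists$. Each atom is arbitrarily assigned a polarity; the literal $\neg A$ has the opposite polarity of the atom $A$. Negation of compound formulas is defined by De Morgan duality: $\neg\neg A=A$, $\neg(A\wedge^{+}B)=\neg A\vee^{-}\neg B$, $\neg(A\vee^{-}B)=\neg A\wedge^{+}\neg B$, $\neg(A\wedge^{-}B)=\neg A\vee^{+}\neg B$, $\neg(A\vee^{+}B)=\neg A\wedge^{-}\neg B$, $\neg\forall xA=\exists x\neg A$, $\neg\exists xA=\forall x\neg A$, and $\neg\mathcal T$, $\neg\mathcal F$ are constants with $\neg(\neg\mathcal T)=\mathcal T$, $\neg(\neg\mathcal F)=\mathcal F$. Implications are abbreviations: $A\supset^{-}B:=\neg A\vee^{-}B$ and $A\supset^{+}B:=\neg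 A\vee^{+}B$. Positive formulas: positive literals, $\mathcal T$, $\mathcal F$, $A\wedge^{+}B$, $A\vee^{+}B$, $A\supset^{+}B$, $\exists xA$. Negative formulas: negative literals, $\neg\mathcal T$, $\neg\mathcal F$, $A\wedge^{-}B$, $A\vee^{-}B$, $A\supset^{-}B$, $\forall xA$. LKF has unfocused sequents $\vdash[\Theta],\Gamma$ and focused sequents $\mapsto[\Theta],A$ (focus on $A$), where $\Theta$ is a multiset of positive formulas and negative literals and $\Gamma$ is a multiset of formulas. Below $P$ is positive, $N$ negative, $C$ a positive formula or negative literal. Rules ("premises $\Rightarrow$ conclusion"): - $[]$: $\vdash[\Theta,C],\Gamma\ \Rightarrow\ \vdash[\Theta],\Gamma,C$. - Focus: $\mapsto[P,\Theta],P\ \Rightarrow\ \vdash[P,\Theta]$. - Release: $\vdash[\Theta],N\ \Rightarrow\ \mapsto[\Theta],N$. - $ID^{+}$ (no premise, $P$ a positive atom): $\mapsto[\neg P,\Theta],P$. - $ID^{-}$ (no premise, $N$ a negative atom): $\mapsto[N,\Theta],\neg N$. - indeed (no premise): $\mapsto[\Theta],\mathcal T$. - absurd (no premise): $\vdash[\Theta],\Gamma,\neg\mathcal F$. - trivial: $\vdash[\Theta],\Gamma\ \Rightarrow\ \vdash[\Theta],\Gamma,\neg\mathcal T$. - $\wedge^{-}$: $\vdash[\Theta],\Gamma,A$ and $\vdash[\Theta],\Gamma,B\ \Rightarrow\ \vdash[\Theta],\Gamma,A\wedge^{-}B$. - $\vee^{-}$: $\vdash[\Theta],\Gamma,A,B\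 \Rightarrow\ \vdash[\Theta],\Gamma,A\vee^{-}B$. - $\supset^{-}$: $\vdash[\Theta],\Gamma,B,\neg A\ \Rightarrow\ \vdash[\Theta],\Gamma,A\supset^{-}B$. - $\forall$: $\vdash[\Theta],\Gamma,A\ \Rightarrow\ \vdash[\Theta],\Gamma,\forall xA$, with $x$ not free in $\Theta,\Gamma$. - $\wedge^{+}$: $\mapsto[\Theta],A$ and $\mapsto[\Theta],B\ \Rightarrow\ \mapsto[\Theta],A\wedge^{+}B$. - $\vee^{+}$ ($i\in\{1,2\}$): $\mapsto[\Theta],A_i\ \Rightarrow\ \mapsto[\Theta],A_1\vee^{+}A_2$. - $\exists$: $\mapsto[\Theta],A[t/x]\ \Rightarrow\ \mapsto[\Theta],\exists xA$, for any term $t$. - $\supset^{+}$ (two rules): $\mapsto[\Theta],\neg A\ \Rightarrow\ \mapsto[\Theta],A\supset^{+}B$; and $\mapsto[\Theta],B\ \Rightarrow\ \mapsto[\Theta],A\supset^{+}B$. End-sequents have the form $\vdash[\,],\Gamma$; a sequent is provable if it is the root of a finite tree of these rules. *)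

theory Defs
  imports Main "HOL-Library.Multiset"
begin

text \<open>
  Terms and formulas use de Bruijn indices: below \<open>k\<close> binders, \<open>Var n\<close> with \<open>n < k\<close> is bound
  and \<open>Var (n + k)\<close> is the free variable \<open>n\<close>. Symbols carry no fixed arity; a symbol
  applied to argument lists of different lengths acts as different symbols.
\<close>

datatype 'f tm = Var nat | Fn 'f "'f tm list"

datatype ('f, 'p) fm =
    Atm 'p "'f tm list"
  | NAtm 'p "'f tm list"
  | TT | FF | NTT | NFF
  | ConP "('f, 'p) fm" "('f, 'p) fm"
  | ConN "('f, 'p) fm" "('f, 'p) fm"
  | DisP "('f, 'p) fm" "('f, 'p) fm"
  | DisN "('f, 'p) fm" "('f, 'p) fm"
  | All "('f, 'p) fm"
  | Ex "('f, 'p) fm"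

fun neg :: "('f, 'p) fm \<Rightarrow> ('f, 'p) fm" where
  "neg (Atm p ts) = NAtm p ts"
| "neg (NAtm p ts) = Atm p ts"
| "neg TT = NTT"
| "neg FF = NFF"
| "neg NTT = TT"
| "neg NFF = FF"
| "neg (ConP A B) = DisN (neg A) (neg B)"
| "neg (ConN A B) = DisP (neg A) (neg B)"
| "neg (DisP A B) = ConN (neg A) (neg B)"
| "neg (DisN A B) = ConP (neg A) (neg B)"
| "neg (All A) = Ex (neg A)"
| "neg (Ex A) = All (neg A)"

abbreviation ImpN :: "('f, 'p) fm \<Rightarrow> ('f, 'p) fm \<Rightarrow> ('f, 'p) fm" where
  "ImpN A B \<equiv> DisN (neg A) B"

abbreviation ImpP :: "('f, 'p) fm \<Rightarrow> ('f, 'p) fm \<Rightarrow> ('f, 'p) fm" where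
  "ImpP A B \<equiv> DisP (neg A) B"

lemma neg_neg [simp]: "neg (neg A) = A"
  by (induction A) auto


section \<open>Substitution and free variables\<close>

primrec subst_tm :: "(nat \<Rightarrow> 'f tm) \<Rightarrow> 'f tm \<Rightarrow> 'f tm" where
  "subst_tm s (Var n) = s n"
| "subst_tm s (Fn f ts) = Fn f (map (subst_tm s) ts)"

definition lift_subst :: "(nat \<Rightarrow> 'f tm) \<Rightarrow> nat \<Rightarrow> 'f tm" where
  "lift_subst s = case_nat (Var 0) (\<lambda>n. subst_tm (\<lambda>m. Var (Suc m)) (s n))"

primrec subst_fm :: "(nat \<Rightarrow> 'f tm) \<Rightarrow> ('f, 'p) fm \<Rightarrow> ('f, 'p) fm" where
  "subst_fm s (Atm p ts) = Atm p (map (subst_tm s) ts)"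
| "subst_fm s (NAtm p ts) = NAtm p (map (subst_tm s) ts)"
| "subst_fm s TT = TT"
| "subst_fm s FF = FF"
| "subst_fm s NTT = NTT"
| "subst_fm s NFF = NFF"
| "subst_fm s (ConP A B) = ConP (subst_fm s A) (subst_fm s B)"
| "subst_fm s (ConN A B) = ConN (subst_fm s A) (subst_fm s B)"
| "subst_fm s (DisP A B) = DisP (subst_fm s A) (subst_fm s B)"
| "subst_fm s (DisN A B) = DisN (subst_fm s A) (subst_fm s B)"
| "subst_fm s (All A) = All (subst_fm (lift_subst s) A)"
| "subst_fm s (Ex A) = Ex (subst_fm (lift_subst s) A)"

text \<open>\<open>inst t A\<close> is \<open>A[t/x]\<close> for the body \<open>A\<close> of a quantified formula with bound variable \<open>x\<close>.\<close>

definition inst :: "'f tm \<Rightarrow> ('f, 'p) fm \<Rightarrow> ('f, 'p) fm" where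
  "inst t A = subst_fm (case_nat t Var) A"

primrec fv_tm :: "'f tm \<Rightarrow> nat set" where
  "fv_tm (Var n) = {n}"
| "fv_tm (Fn f ts) = \<Union> (set (map fv_tm ts))"

primrec fv :: "('f, 'p) fm \<Rightarrow> nat set" where
  "fv (Atm p ts) = \<Union> (fv_tm ` set ts)"
| "fv (NAtm p ts) = \<Union> (fv_tm ` set ts)"
| "fv TT = {}"
| "fv FF = {}"
| "fv NTT = {}"
| "fv NFF = {}"
| "fv (ConP A B) = fv A \<union> fv B"
| "fv (ConN A B) = fv A \<union> fv B"
| "fv (DisP A B) = fv A \<union> fv B"
| "fv (DisN A B) = fv A \<union> fv B"
| "fv (All A) = {n. Suc n \<in> fv A}"
| "fv (Ex A) = {n. Suc n \<in> fv A}"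


section \<open>Polarity and the calculus LKF\<close>

datatype polarity = Positive | Negative

text \<open>
  A polarity assignment \<open>pol\<close> is an arbitrary function on atomic formulas; in particular it
  need not be stable under substitution.
\<close>

fun positive :: "('p \<Rightarrow> 'f tm list \<Rightarrow> polarity) \<Rightarrow> ('f, 'p) fm \<Rightarrow> bool" where
  "positive pol (Atm p ts) \<longleftrightarrow> pol p ts = Positive"
| "positive pol (NAtm p ts) \<longleftrightarrow> pol p ts = Negative"
| "positive pol TT \<longleftrightarrow> True"
| "positive pol FF \<longleftrightarrow> True"
| "positive pol NTT \<longleftrightarrow> False"
| "positive pol NFF \<longleftrightarrow> False"
| "positive pol (ConP A B) \<longleftrightarrow> True"
| "positive pol (ConN A B) \<longleftrightarrow> False"
| "positive pol (DisP A B) \<longleftrightarrow> True"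
| "positive pol (DisN A B) \<longleftrightarrow> False"
| "positive pol (All A) \<longleftrightarrow> False"
| "positive pol (Ex A) \<longleftrightarrow> True"

abbreviation negative :: "('p \<Rightarrow> 'f tm list \<Rightarrow> polarity) \<Rightarrow> ('f, 'p) fm \<Rightarrow> bool" where
  "negative pol A \<equiv> \<not> positive pol A"

fun literal :: "('f, 'p) fm \<Rightarrow> bool" where
  "literal (Atm p ts) \<longleftrightarrow> True"
| "literal (NAtm p ts) \<longleftrightarrow> True"
| "literal _ \<longleftrightarrow> False"

definition storable :: "('p \<Rightarrow> 'f tm list \<Rightarrow> polarity) \<Rightarrow> ('f, 'p) fm \<Rightarrow> bool" where
  "storable pol C \<longleftrightarrow> positive pol C \<or> (negative pol C \<and> literal C)"

text \<open>
  \<open>unfoc pol \<Theta> \<Gamma>\<close> is the provability of the unfocused sequent with store \<open>\<Theta>\<close>, and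
  \<open>foc pol \<Theta> A\<close> that of the sequent focused on \<open>A\<close>. Rule \<open>Store\<close> is the only one whose
  premise has a larger store than its conclusion, and it adds a storable formula. So all
  stores in a derivation of \<open>unfoc pol {#} \<Gamma>\<close> consist of positive formulas and negative literals.

  In rule \<open>Forall\<close> the bound variable is opened with a name \<open>x\<close>. That \<open>x\<close> is not free in
  \<open>All A\<close> itself holds by \<open>\<alpha>\<close>-conversion in named syntax and is a side condition here.
\<close>

inductive unfoc ::
    "('p \<Rightarrow> 'f tm list \<Rightarrow> polarity) \<Rightarrow> ('f, 'p) fm multiset \<Rightarrow> ('f, 'p) fm multiset \<Rightarrow> bool"
  and foc ::
    "('p \<Rightarrow> 'f tm list \<Rightarrow> polarity) \<Rightarrow> ('f, 'p) fm multiset \<Rightarrow> ('f, 'p) fm \<Rightarrow> bool"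
  for pol :: "'p \<Rightarrow> 'f tm list \<Rightarrow> polarity"
where
  Store: "storable pol C \<Longrightarrow> unfoc pol (add_mset C \<Theta>) \<Gamma> \<Longrightarrow> unfoc pol \<Theta> (add_mset C \<Gamma>)"
| Focus: "positive pol P \<Longrightarrow> foc pol (add_mset P \<Theta>) P \<Longrightarrow> unfoc pol (add_mset P \<Theta>) {#}"
| Release: "negative pol N \<Longrightarrow> unfoc pol \<Theta> {#N#} \<Longrightarrow> foc pol \<Theta> N"
| IdP: "pol p ts = Positive \<Longrightarrow> foc pol (add_mset (NAtm p ts) \<Theta>) (Atm p ts)"
| IdN: "pol p ts = Negative \<Longrightarrow> foc pol (add_mset (Atm p ts) \<Theta>) (NAtm p ts)"
| Indeed: "foc pol \<Theta> TT"
| Absurd: "unfoc pol \<Theta> (add_mset NFF \<Gamma>)"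
| Trivial: "unfoc pol \<Theta> \<Gamma> \<Longrightarrow> unfoc pol \<Theta> (add_mset NTT \<Gamma>)"
| AndN: "unfoc pol \<Theta> (add_mset A \<Gamma>) \<Longrightarrow> unfoc pol \<Theta> (add_mset B \<Gamma>) \<Longrightarrow>
    unfoc pol \<Theta> (add_mset (ConN A B) \<Gamma>)"
| OrN: "unfoc pol \<Theta> (add_mset A (add_mset B \<Gamma>)) \<Longrightarrow> unfoc pol \<Theta> (add_mset (DisN A B) \<Gamma>)"
| ImplN: "unfoc pol \<Theta> (add_mset B (add_mset (neg A) \<Gamma>)) \<Longrightarrow>
    unfoc pol \<Theta> (add_mset (ImpN A B) \<Gamma>)"
| Forall: "(\<forall>B \<in># \<Theta> + \<Gamma>. x \<notin> fv B) \<Longrightarrow> x \<notin> fv (All A) \<Longrightarrow>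
    unfoc pol \<Theta> (add_mset (inst (Var x) A) \<Gamma>) \<Longrightarrow> unfoc pol \<Theta> (add_mset (All A) \<Gamma>)"
| AndP: "foc pol \<Theta> A \<Longrightarrow> foc pol \<Theta> B \<Longrightarrow> foc pol \<Theta> (ConP A B)"
| OrP1: "foc pol \<Theta> A \<Longrightarrow> foc pol \<Theta> (DisP A B)"
| OrP2: "foc pol \<Theta> B \<Longrightarrow> foc pol \<Theta> (DisP A B)"
| Exists: "foc pol \<Theta> (inst t A) \<Longrightarrow> foc pol \<Theta> (Ex A)"
| ImplP1: "foc pol \<Theta> (neg A) \<Longrightarrow> foc pol \<Theta> (ImpP A B)"
| ImplP2: "foc pol \<Theta> B \<Longrightarrow> foc pol \<Theta> (ImpP A B)"


section \<open>Classical semantics\<close>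

definition is_structure :: "'u set \<Rightarrow> ('f \<Rightarrow> 'u list \<Rightarrow> 'u) \<Rightarrow> bool" where
  "is_structure D F \<longleftrightarrow> D \<noteq> {} \<and> (\<forall>f us. set us \<subseteq> D \<longrightarrow> F f us \<in> D)"

primrec eval :: "('f \<Rightarrow> 'u list \<Rightarrow> 'u) \<Rightarrow> (nat \<Rightarrow> 'u) \<Rightarrow> 'f tm \<Rightarrow> 'u" where
  "eval F e (Var n) = e n"
| "eval F e (Fn f ts) = F f (map (eval F e) ts)"

primrec sat :: "'u set \<Rightarrow> ('f \<Rightarrow> 'u list \<Rightarrow> 'u) \<Rightarrow> ('p \<Rightarrow> 'u list \<Rightarrow> bool) \<Rightarrow>
    (nat \<Rightarrow> 'u) \<Rightarrow> ('f, 'p) fm \<Rightarrow> bool" where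
  "sat D F R e (Atm p ts) \<longleftrightarrow> R p (map (eval F e) ts)"
| "sat D F R e (NAtm p ts) \<longleftrightarrow> \<not> R p (map (eval F e) ts)"
| "sat D F R e TT \<longleftrightarrow> True"
| "sat D F R e FF \<longleftrightarrow> False"
| "sat D F R e NTT \<longleftrightarrow> False"
| "sat D F R e NFF \<longleftrightarrow> True"
| "sat D F R e (ConP A B) \<longleftrightarrow> sat D F R e A \<and> sat D F R e B"
| "sat D F R e (ConN A B) \<longleftrightarrow> sat D F R e A \<and> sat D F R e B"
| "sat D F R e (DisP A B) \<longleftrightarrow> sat D F R e A \<or> sat D F R e B"
| "sat D F R e (DisN A B) \<longleftrightarrow> sat D F R e A \<or> sat D F R e B"
| "sat D F R e (All A) \<longleftrightarrow> (\<forall>u \<in> D. sat D F R (case_nat u e) A)"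
| "sat D F R e (Ex A) \<longleftrightarrow> (\<exists>u \<in> D. sat D F R (case_nat u e) A)"

lemma sat_neg: "sat D F R e (neg A) \<longleftrightarrow> \<not> sat D F R e A"
  by (induction A arbitrary: e) auto

lemma sat_ImpN: "sat D F R e (ImpN A B) \<longleftrightarrow> (sat D F R e A \<longrightarrow> sat D F R e B)"
  by (auto simp: sat_neg)

lemma sat_ImpP: "sat D F R e (ImpP A B) \<longleftrightarrow> (sat D F R e A \<longrightarrow> sat D F R e B)"
  by (auto simp: sat_neg)

text \<open>
  Classical validity of the disjunction of the formulas in \<open>\<Gamma>\<close>: in every structure with a
  nonempty domain \<open>D\<close> and under every assignment into \<open>D\<close>, some formula of \<open>\<Gamma>\<close> is true.
  HOL cannot quantify over types in a formula, so the type \<open>'u\<close> from which the domains are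
  taken is a parameter. As \<open>'u\<close> ranges over the infinite types, domains of all sizes occur,
  finite ones included. For finite \<open>'u\<close> this validity is too weak for completeness.
\<close>

definition valid_disj :: "'u itself \<Rightarrow> ('f, 'p) fm multiset \<Rightarrow> bool" where
  "valid_disj (_ :: 'u itself) \<Gamma> \<longleftrightarrow>
    (\<forall>(D :: 'u set) F R e. is_structure D F \<and> range e \<subseteq> D \<longrightarrow> (\<exists>A \<in># \<Gamma>. sat D F R e A))"

end

theory Submission
  imports Defs "HOL-Library.Countable_Set"
begin

text \<open>
  Soundness is an induction on derivations. Completeness is a Henkin-style argument that avoids
  cut elimination. Since the polarity of an atom may change under substitution, eigenvariables
  cannot be renamed in derivations, so even weakening of the store is not evident. We therefore
  work with \<^emph>\<open>persistent\<close> provability: provability from every store extending a given set. It is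
  monotone by definition and satisfies the rules of LKF, where the universal rule has one premise
  for every variable instead of an eigenvariable condition.

  If \<open>\<Gamma>\<close> is not persistently provable, then decomposing its negative formulas yields a store
  that is not persistently provable. We enumerate the negative formulas over the (finitely many)
  symbols of \<open>\<Gamma>\<close>, and whenever one of them is not persistently provable under focus we decompose
  it into an extension of the store. The union of the resulting chain defines a term model in
  which every stored formula, every formula that never becomes persistently provable under focus
  along the chain, and every formula of \<open>\<Gamma>\<close> is false. The term model is countable, hence embeds
  into any infinite type.
\<close>

section \<open>Soundness\<close>

lemma eval_subst_tm: "eval F e (subst_tm s t) = eval F (\<lambda>n. eval F e (s n)) t"
  by (induction t) (auto simp: comp_def cong: map_cong)

text \<open>The shift inside \<open>lift_subst\<close> makes the substituted terms skip the newly
  bound index 0, so \<open>u\<close> is invisible to them.\<close>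

lemma eval_lift_subst:
  "(\<lambda>n. eval F (case_nat u e) (lift_subst s n)) = case_nat u (\<lambda>n. eval F e (s n))"
  by (rule ext) (auto simp: lift_subst_def eval_subst_tm split: nat.split)

lemma sat_subst_fm: "sat D F R e (subst_fm s A) \<longleftrightarrow> sat D F R (\<lambda>n. eval F e (s n)) A"
  by (induction A arbitrary: e s) (simp_all add: comp_def eval_subst_tm eval_lift_subst)

lemma sat_inst: "sat D F R e (inst t A) \<longleftrightarrow> sat D F R (case_nat (eval F e t) e) A"
proof -
  have "(\<lambda>n. eval F e (case_nat t Var n)) = case_nat (eval F e t) e"
    by (rule ext) (simp split: nat.split)
  then show ?thesis
    by (simp add: inst_def sat_subst_fm)
qed

lemma eval_cong_fv: "(\<And>n. n \<in> fv_tm t \<Longrightarrow> e n = e' n) \<Longrightarrow> eval F e t = eval F e' t"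
proof (induction t)
  case (Fn f ts)
  then have "map (eval F e) ts = map (eval F e') ts"
    by (intro map_cong) auto
  then show ?case by (metis eval.simps(2))
qed simp

lemma map_eval_cong_fv:
  "(\<And>n. n \<in> \<Union> (fv_tm ` set ts) \<Longrightarrow> e n = e' n) \<Longrightarrow> map (eval F e) ts = map (eval F e') ts"
  by (rule map_cong) (auto intro: eval_cong_fv)

lemma sat_cong_fv: "(\<And>n. n \<in> fv A \<Longrightarrow> e n = e' n) \<Longrightarrow> sat D F R e A \<longleftrightarrow> sat D F R e' A"
proof (induction A arbitrary: e e')
  case (Atm p ts)
  then show ?case using map_eval_cong_fv[of ts e e' F] by (metis fv.simps(1,2) sat.simps(1,2))
next
  case (NAtm p ts)
  then show ?case using map_eval_cong_fv[of ts e e' F] by (metis fv.simps(1,2) sat.simps(1,2))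
next
  case (ConP A B)
  have "sat D F R e A = sat D F R e' A"
    by (rule ConP.IH(1)) (simp add: ConP.prems)
  moreover have "sat D F R e B = sat D F R e' B"
    by (rule ConP.IH(2)) (simp add: ConP.prems)
  ultimately show ?case by simp
next
  case (ConN A B)
  have "sat D F R e A = sat D F R e' A"
    by (rule ConN.IH(1)) (simp add: ConN.prems)
  moreover have "sat D F R e B = sat D F R e' B"
    by (rule ConN.IH(2)) (simp add: ConN.prems)
  ultimately show ?case by simp
next
  case (DisP A B)
  have "sat D F R e A = sat D F R e' A"
    by (rule DisP.IH(1)) (simp add: DisP.prems)
  moreover have "sat D F R e B = sat D F R e' B"
    by (rule DisP.IH(2)) (simp add: DisP.prems)
  ultimately show ?case by simp
next
  case (DisN A B)
  have "sat D F R e A = sat D F R e' A"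
    by (rule DisN.IH(1)) (simp add: DisN.prems)
  moreover have "sat D F R e B = sat D F R e' B"
    by (rule DisN.IH(2)) (simp add: DisN.prems)
  ultimately show ?case by simp
next
  case (All A)
  have "sat D F R (case_nat u e) A = sat D F R (case_nat u e') A" for u
    by (rule All.IH) (auto simp: All.prems split: nat.split)
  then show ?case by simp
next
  case (Ex A)
  have "sat D F R (case_nat u e) A = sat D F R (case_nat u e') A" for u
    by (rule Ex.IH) (auto simp: Ex.prems split: nat.split)
  then show ?case by simp
qed simp_all

lemma eval_in_structure:
  assumes "is_structure D F" and "range e \<subseteq> D"
  shows "eval F e t \<in> D"
proof (induction t)
  case (Var n)
  then show ?case using assms(2) by auto
next
  case (Fn f ts)
  then have "set (map (eval F e) ts) \<subseteq> D" by auto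
  then show ?case using assms(1) by (simp add: is_structure_def)
qed

text \<open>The store and the formulas outside it are read as one disjunction. The assignment stays
  quantified inside the claim because the universal rule uses its induction hypothesis at a modified
  assignment.\<close>

lemma LKF_sound:
  assumes "is_structure D F"
  shows "unfoc pol \<Theta> \<Gamma> \<Longrightarrow> \<forall>e. range e \<subseteq> D \<longrightarrow> (\<exists>A \<in># \<Theta> + \<Gamma>. sat D F R e A)"
    and "foc pol \<Theta> A \<Longrightarrow> \<forall>e. range e \<subseteq> D \<longrightarrow> (\<exists>B \<in># add_mset A \<Theta>. sat D F R e B)"
proof (induction rule: unfoc_foc.inducts)
  case (Forall \<Theta> \<Gamma> x A)
  show ?case
  proof (intro allI impI, rule ccontr)
    fix e :: "nat \<Rightarrow> 'a"
    assume e: "range e \<subseteq> D" and "\<not> (\<exists>B \<in># \<Theta> + add_mset (All A) \<Gamma>. sat D F R e B)"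
    then obtain u where others: "\<And>B. B \<in># \<Theta> + \<Gamma> \<Longrightarrow> \<not> sat D F R e B"
      and u: "u \<in> D" "\<not> sat D F R (case_nat u e) A"
      by auto
    \<comment> \<open>The eigenvariable receives the counterexample as its value. Freshness of
      \<open>x\<close> keeps all other formulas false, and the instance in the premise becomes false
      as well.\<close>
    let ?e = "e(x := u)"
    have "sat D F R ?e B = sat D F R e B" if "B \<in># \<Theta> + \<Gamma>" for B
      using that Forall(1) by (intro sat_cong_fv) auto
    moreover have "sat D F R (case_nat u ?e) A = sat D F R (case_nat u e) A"
      using Forall(2) by (intro sat_cong_fv) (auto split: nat.split)
    then have "\<not> sat D F R ?e (inst (Var x) A)"
      using u by (simp add: sat_inst)
    moreover have "range ?e \<subseteq> D"
      using e u by auto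
    ultimately show False
      using Forall(4)[rule_format, of ?e] others by auto
  qed
next
  case (Exists \<Theta> t A)
  show ?case
  proof (intro allI impI)
    fix e :: "nat \<Rightarrow> 'a"
    assume e: "range e \<subseteq> D"
    then have "\<exists>B \<in># add_mset (inst t A) \<Theta>. sat D F R e B"
      using Exists by blast
    moreover have "eval F e t \<in> D"
      using assms e by (rule eval_in_structure)
    ultimately show "\<exists>B \<in># add_mset (Ex A) \<Theta>. sat D F R e B"
      by (auto simp: sat_inst)
  qed
qed fastforce+

section \<open>Persistent provability\<close>

text \<open>Stores are finite, so this holds vacuously for infinite \<open>S\<close>. Completeness
  therefore argues along a chain of sets and not with their union, which may be infinite.\<close>

definition punfoc ::
    "('p \<Rightarrow> 'f tm list \<Rightarrow> polarity) \<Rightarrow> ('f, 'p) fm set \<Rightarrow> ('f, 'p) fm multiset \<Rightarrow> bool" where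
  "punfoc pol S \<Gamma> \<longleftrightarrow> (\<forall>\<Theta>. S \<subseteq> set_mset \<Theta> \<longrightarrow> unfoc pol \<Theta> \<Gamma>)"

definition pfoc ::
    "('p \<Rightarrow> 'f tm list \<Rightarrow> polarity) \<Rightarrow> ('f, 'p) fm set \<Rightarrow> ('f, 'p) fm \<Rightarrow> bool" where
  "pfoc pol S A \<longleftrightarrow> (\<forall>\<Theta>. S \<subseteq> set_mset \<Theta> \<longrightarrow> foc pol \<Theta> A)"

lemma pfoc_mono: "pfoc pol S A \<Longrightarrow> S \<subseteq> S' \<Longrightarrow> pfoc pol S' A"
  by (auto simp: pfoc_def)

lemma punfoc_Store:
  "storable pol C \<Longrightarrow> punfoc pol (insert C S) \<Gamma> \<Longrightarrow> punfoc pol S (add_mset C \<Gamma>)"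
  unfolding punfoc_def by (metis Store insert_mono set_mset_add_mset_insert)

lemma punfoc_Focus: "P \<in> S \<Longrightarrow> positive pol P \<Longrightarrow> pfoc pol S P \<Longrightarrow> punfoc pol S {#}"
  unfolding punfoc_def pfoc_def by (metis Focus multi_member_split subsetD)

lemma pfoc_Release: "negative pol N \<Longrightarrow> punfoc pol S {#N#} \<Longrightarrow> pfoc pol S N"
  unfolding punfoc_def pfoc_def by (metis Release)

lemma pfoc_IdP: "pol p ts = Positive \<Longrightarrow> NAtm p ts \<in> S \<Longrightarrow> pfoc pol S (Atm p ts)"
  unfolding pfoc_def by (metis IdP multi_member_split subsetD)

lemma pfoc_IdN: "pol p ts = Negative \<Longrightarrow> Atm p ts \<in> S \<Longrightarrow> pfoc pol S (NAtm p ts)"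
  unfolding pfoc_def by (metis IdN multi_member_split subsetD)

lemma pfoc_TT: "pfoc pol S TT"
  by (simp add: pfoc_def Indeed)

lemma punfoc_NFF: "punfoc pol S (add_mset NFF \<Gamma>)"
  by (simp add: punfoc_def Absurd)

lemma punfoc_NTT: "punfoc pol S \<Gamma> \<Longrightarrow> punfoc pol S (add_mset NTT \<Gamma>)"
  by (simp add: punfoc_def Trivial)

lemma punfoc_ConN:
  "punfoc pol S (add_mset A \<Gamma>) \<Longrightarrow> punfoc pol S (add_mset B \<Gamma>) \<Longrightarrow>
    punfoc pol S (add_mset (ConN A B) \<Gamma>)"
  by (simp add: punfoc_def AndN)

lemma punfoc_DisN:
  "punfoc pol S (add_mset A (add_mset B \<Gamma>)) \<Longrightarrow> punfoc pol S (add_mset (DisN A B) \<Gamma>)"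
  by (simp add: punfoc_def OrN)

lemma finite_fv_tm: "finite (fv_tm t)"
  by (induction t) auto

lemma finite_fv: "finite (fv A)"
proof (induction A)
  case (All A)
  then have "finite (Suc -` fv A)" by (rule finite_vimageI) simp
  then show ?case by (simp add: vimage_def)
next
  case (Ex A)
  then have "finite (Suc -` fv A)" by (rule finite_vimageI) simp
  then show ?case by (simp add: vimage_def)
qed (auto simp: finite_fv_tm)

lemma punfoc_All:
  assumes "\<And>x. punfoc pol S (add_mset (inst (Var x) A) \<Gamma>)"
  shows "punfoc pol S (add_mset (All A) \<Gamma>)"
  unfolding punfoc_def
proof (intro allI impI)
  fix \<Theta> assume \<Theta>: "S \<subseteq> set_mset \<Theta>"
  \<comment> \<open>The variable is chosen only after the store \<open>\<Theta>\<close> is fixed. As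
    the assumption covers every variable, it covers one that is fresh for this store, and nothing
    has to be renamed.\<close>
  let ?V = "fv (All A) \<union> (\<Union>B \<in> set_mset (\<Theta> + \<Gamma>). fv B)"
  have "finite ?V"
    using finite_fv by blast
  then obtain x where x: "x \<notin> ?V"
    using ex_new_if_finite infinite_UNIV_nat by blast
  have "unfoc pol \<Theta> (add_mset (inst (Var x) A) \<Gamma>)"
    using assms \<Theta> by (simp add: punfoc_def)
  then show "unfoc pol \<Theta> (add_mset (All A) \<Gamma>)"
    using x by (intro Forall[of \<Theta> \<Gamma> x A]) blast+
qed

lemma pfoc_ConP: "pfoc pol S A \<Longrightarrow> pfoc pol S B \<Longrightarrow> pfoc pol S (ConP A B)"
  by (simp add: pfoc_def AndP)

lemma pfoc_DisP1: "pfoc pol S A \<Longrightarrow> pfoc pol S (DisP A B)"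
  by (simp add: pfoc_def OrP1)

lemma pfoc_DisP2: "pfoc pol S B \<Longrightarrow> pfoc pol S (DisP A B)"
  by (simp add: pfoc_def OrP2)

lemma pfoc_Ex: "pfoc pol S (inst t A) \<Longrightarrow> pfoc pol S (Ex A)"
  unfolding pfoc_def by (metis Exists)

section \<open>Decomposition of negative formulas\<close>

text \<open>
  \<open>refuted pol S A\<close>: some path through the asynchronous decomposition of \<open>A\<close> ends with all its
  stored formulas in \<open>S\<close>.
\<close>

inductive refuted ::
    "('p \<Rightarrow> 'f tm list \<Rightarrow> polarity) \<Rightarrow> ('f, 'p) fm set \<Rightarrow> ('f, 'p) fm \<Rightarrow> bool"
  for pol S where
  stored: "storable pol C \<Longrightarrow> C \<in> S \<Longrightarrow> refuted pol S C"
| NTT: "refuted pol S NTT"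
| ConN1: "refuted pol S A \<Longrightarrow> refuted pol S (ConN A B)"
| ConN2: "refuted pol S B \<Longrightarrow> refuted pol S (ConN A B)"
| DisN: "refuted pol S A \<Longrightarrow> refuted pol S B \<Longrightarrow> refuted pol S (DisN A B)"
| All: "refuted pol S (inst (Var x) A) \<Longrightarrow> refuted pol S (All A)"

lemma refuted_mono: "refuted pol S A \<Longrightarrow> S \<subseteq> S' \<Longrightarrow> refuted pol S' A"
  by (induction rule: refuted.induct) (auto intro: refuted.intros)

text \<open>Terms do not count, so instantiation preserves the weight. Constants and literals weigh
  1, so moving a formula to the store or dropping it lowers the total weight too.\<close>

primrec cx :: "('f, 'p) fm \<Rightarrow> nat" where
  "cx (Atm p ts) = 1"
| "cx (NAtm p ts) = 1"
| "cx TT = 1"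
| "cx FF = 1"
| "cx NTT = 1"
| "cx NFF = 1"
| "cx (ConP A B) = cx A + cx B + 1"
| "cx (ConN A B) = cx A + cx B + 1"
| "cx (DisP A B) = cx A + cx B + 1"
| "cx (DisN A B) = cx A + cx B + 1"
| "cx (All A) = cx A + 1"
| "cx (Ex A) = cx A + 1"

lemma cx_pos: "cx A > 0"
  by (induction A) auto

lemma cx_inst [simp]: "cx (inst t A) = cx A"
proof -
  have "cx (subst_fm s A) = cx A" for s :: "nat \<Rightarrow> 'a tm"
    by (induction A arbitrary: s) auto
  then show ?thesis by (simp add: inst_def)
qed

text \<open>Each asynchronous rule is read contrapositively: if its conclusion is not persistently
  provable, neither is one of its premises. Following such premises until no formula is left outside
  the store traces the path that \<open>refuted\<close> records.\<close>

lemma decompose: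
  assumes "\<not> punfoc pol S \<Gamma>"
  shows "\<exists>S'. S \<subseteq> S' \<and> \<not> punfoc pol S' {#} \<and> (\<forall>A \<in># \<Gamma>. refuted pol S' A)"
  using assms
proof (induction "\<Sum>A \<in># \<Gamma>. cx A" arbitrary: S \<Gamma> rule: less_induct)
  case less
  show ?case
  proof (cases \<Gamma>)
    case empty
    then show ?thesis using less.prems by auto
  next
    case (add A \<Gamma>')
    \<comment> \<open>One formula \<open>A\<close> is replaced by a multiset \<open>\<Delta>\<close>
      of smaller total weight, while the store may change to \<open>T\<close>.\<close>
    have IH: "\<exists>S'. T \<subseteq> S' \<and> \<not> punfoc pol S' {#} \<and> (\<forall>B \<in># \<Delta> + \<Gamma>'. refuted pol S' B)"
      if "\<not> punfoc pol T (\<Delta> + \<Gamma>')" and "(\<Sum>B \<in># \<Delta>. cx B) < cx A" for T \<Delta>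
      using that by (intro less.hyps) (auto simp: add)
    have unp: "\<not> punfoc pol S (add_mset A \<Gamma>')"
      using less.prems add by simp
    show ?thesis
    proof (cases "storable pol A")
      case True
      then have "\<not> punfoc pol (insert A S) ({#} + \<Gamma>')"
        using unp punfoc_Store by auto
      then obtain S' where "insert A S \<subseteq> S'" "\<not> punfoc pol S' {#}" "\<forall>B \<in># \<Gamma>'. refuted pol S' B"
        using IH[of "insert A S" "{#}"] cx_pos[of A] by auto
      then show ?thesis
        using True by (intro exI[of _ S']) (auto simp: add intro: refuted.stored)
    next
      case False
      then consider "A = NTT" | "A = NFF" | B C where "A = ConN B C" | B C where "A = DisN B C"
        | B where "A = All B"
        by (cases A) (auto simp: storable_def)
      then show ?thesis
      proof cases
        case 1
        then have "\<not> punfoc pol S ({#} + \<Gamma>')" using unp punfoc_NTT by auto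
        then show ?thesis using IH[of S "{#}"] 1 by (auto simp: add intro: refuted.NTT)
      next
        case 2
        then show ?thesis using unp punfoc_NFF by auto
      next
        case (3 B C)
        then consider "\<not> punfoc pol S ({#B#} + \<Gamma>')" | "\<not> punfoc pol S ({#C#} + \<Gamma>')"
          using unp punfoc_ConN[of pol S B \<Gamma>' C] by auto
        then show ?thesis
        proof cases
          case 1
          then show ?thesis using IH[of S "{#B#}"] 3 by (auto simp: add intro: refuted.ConN1)
        next
          case 2
          then show ?thesis using IH[of S "{#C#}"] 3 by (auto simp: add intro: refuted.ConN2)
        qed
      next
        case (4 B C)
        then have "\<not> punfoc pol S ({#B, C#} + \<Gamma>')"
          using unp punfoc_DisN[of pol S B C \<Gamma>'] by auto
        then show ?thesis using IH[of S "{#B, C#}"] 4 by (auto simp: add intro: refuted.DisN)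
      next
        case (5 B)
        then obtain x where "\<not> punfoc pol S ({#inst (Var x) B#} + \<Gamma>')"
          using unp punfoc_All by fastforce
        then show ?thesis
          using IH[of S "{#inst (Var x) B#}"] 5 by (auto simp: add intro: refuted.All)
      qed
    qed
  qed
qed

section \<open>Formulas over countably many symbols\<close>

instance tm :: (countable) countable
  by countable_datatype

instance fm :: (countable, countable) countable
  by countable_datatype

definition tms_over :: "'f set \<Rightarrow> 'f tm set" where
  "tms_over Fs = {t. set_tm t \<subseteq> Fs}"

definition fms_over :: "'f set \<Rightarrow> 'p set \<Rightarrow> ('f, 'p) fm set" where
  "fms_over Fs Ps = {A. set1_fm A \<subseteq> Fs \<and> set2_fm A \<subseteq> Ps}"

lemma Var_in_tms_over [simp]: "Var n \<in> tms_over Fs"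
  by (simp add: tms_over_def)

lemma Fn_in_tms_over [simp]: "Fn f ts \<in> tms_over Fs \<longleftrightarrow> f \<in> Fs \<and> set ts \<subseteq> tms_over Fs"
  by (auto simp: tms_over_def)

lemma fms_over_simps [simp]:
  "Atm p ts \<in> fms_over Fs Ps \<longleftrightarrow> p \<in> Ps \<and> set ts \<subseteq> tms_over Fs"
  "NAtm p ts \<in> fms_over Fs Ps \<longleftrightarrow> p \<in> Ps \<and> set ts \<subseteq> tms_over Fs"
  "ConP A B \<in> fms_over Fs Ps \<longleftrightarrow> A \<in> fms_over Fs Ps \<and> B \<in> fms_over Fs Ps"
  "ConN A B \<in> fms_over Fs Ps \<longleftrightarrow> A \<in> fms_over Fs Ps \<and> B \<in> fms_over Fs Ps"
  "DisP A B \<in> fms_over Fs Ps \<longleftrightarrow> A \<in> fms_over Fs Ps \<and> B \<in> fms_over Fs Ps"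
  "DisN A B \<in> fms_over Fs Ps \<longleftrightarrow> A \<in> fms_over Fs Ps \<and> B \<in> fms_over Fs Ps"
  "All A \<in> fms_over Fs Ps \<longleftrightarrow> A \<in> fms_over Fs Ps"
  "Ex A \<in> fms_over Fs Ps \<longleftrightarrow> A \<in> fms_over Fs Ps"
  by (auto simp: fms_over_def tms_over_def)

lemma subst_tm_in_tms_over:
  "t \<in> tms_over Fs \<Longrightarrow> range s \<subseteq> tms_over Fs \<Longrightarrow> subst_tm s t \<in> tms_over Fs"
  by (induction t) auto

lemma lift_subst_in_tms_over:
  assumes "range s \<subseteq> tms_over Fs"
  shows "range (lift_subst s) \<subseteq> tms_over Fs"
proof -
  have "subst_tm (\<lambda>m. Var (Suc m)) (s n) \<in> tms_over Fs" for n
    using assms by (intro subst_tm_in_tms_over) auto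
  then show ?thesis
    by (auto simp: lift_subst_def split: nat.split)
qed

lemma subst_fm_in_fms_over:
  "A \<in> fms_over Fs Ps \<Longrightarrow> range s \<subseteq> tms_over Fs \<Longrightarrow> subst_fm s A \<in> fms_over Fs Ps"
proof (induction A arbitrary: s)
  case (All A)
  from All.prems(2) have "range (lift_subst s) \<subseteq> tms_over Fs"
    by (rule lift_subst_in_tms_over)
  then show ?case using All by simp
next
  case (Ex A)
  from Ex.prems(2) have "range (lift_subst s) \<subseteq> tms_over Fs"
    by (rule lift_subst_in_tms_over)
  then show ?case using Ex by simp
qed (auto intro!: subst_tm_in_tms_over)

lemma inst_in_fms_over:
  "A \<in> fms_over Fs Ps \<Longrightarrow> t \<in> tms_over Fs \<Longrightarrow> inst t A \<in> fms_over Fs Ps"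
  unfolding inst_def by (rule subst_fm_in_fms_over) (auto split: nat.split)

text \<open>The type of symbols may be uncountable. Numbering the symbols in \<open>Fs\<close>
  exhibits every term over \<open>Fs\<close> as the image of a term whose symbols are natural
  numbers.\<close>

lemma countable_tms_over:
  assumes "countable Fs"
  shows "countable (tms_over Fs)"
proof -
  have "tms_over Fs \<subseteq> range (map_tm (from_nat_into Fs))"
  proof
    fix t assume "t \<in> tms_over Fs"
    then have "map_tm (from_nat_into Fs \<circ> to_nat_on Fs) t = t"
      using assms by (intro tm.map_ident_strong) (auto simp: tms_over_def)
    then show "t \<in> range (map_tm (from_nat_into Fs))"
      by (metis rangeI tm.map_comp)
  qed
  then show ?thesis
    by (rule countable_subset) simp
qed

lemma countable_fms_over:
  assumes "countable Fs" and "countable Ps"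
  shows "countable (fms_over Fs Ps)"
proof -
  have "fms_over Fs Ps \<subseteq> range (map_fm (from_nat_into Fs) (from_nat_into Ps))"
  proof
    fix A assume "A \<in> fms_over Fs Ps"
    then have "map_fm (from_nat_into Fs \<circ> to_nat_on Fs) (from_nat_into Ps \<circ> to_nat_on Ps) A = A"
      using assms by (intro fm.map_ident_strong) (auto simp: fms_over_def)
    then show "A \<in> range (map_fm (from_nat_into Fs) (from_nat_into Ps))"
      by (metis rangeI fm.map_comp)
  qed
  then show ?thesis
    by (rule countable_subset) simp
qed

lemma finite_symbols: "finite (set1_fm A)" "finite (set2_fm A)"
proof -
  have "finite (set_tm t)" for t :: "'a tm"
    by (induction t) auto
  then show "finite (set1_fm A)" "finite (set2_fm A)"
    by (induction A) auto
qed

section \<open>Completeness\<close>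

text \<open>One visit to each formula suffices: a formula that is not persistently provable under
  focus at any stage is not so at its own stage, where \<open>Release\<close>, read
  contrapositively, allows it to be decomposed.\<close>

lemma saturated_chain:
  assumes "\<not> punfoc pol {} \<Gamma>" and "countable L"
  obtains S :: "nat \<Rightarrow> ('f, 'p) fm set" where "mono S" "\<And>n. \<not> punfoc pol (S n) {#}"
    "\<And>A. A \<in># \<Gamma> \<Longrightarrow> refuted pol (\<Union>n. S n) A"
    "\<And>N. N \<in> L \<Longrightarrow> negative pol N \<Longrightarrow> (\<And>n. \<not> pfoc pol (S n) N) \<Longrightarrow> refuted pol (\<Union>n. S n) N"
proof -
  define N where "N = from_nat_into L"
  have step: "\<exists>T'. T \<subseteq> T' \<and> \<not> punfoc pol T' {#} \<and>
      (negative pol A \<longrightarrow> \<not> pfoc pol T A \<longrightarrow> refuted pol T' A)"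
    if "\<not> punfoc pol T {#}" for T A
  proof (cases "negative pol A \<and> \<not> pfoc pol T A")
    case True
    then have "\<not> punfoc pol T {#A#}" using pfoc_Release by blast
    from decompose[OF this] show ?thesis by auto
  qed (use that in auto)
  obtain S0 where S0: "\<not> punfoc pol S0 {#}" "\<forall>A \<in># \<Gamma>. refuted pol S0 A"
    using decompose[OF assms(1)] by blast
  \<comment> \<open>The conjunct about \<open>n = 0\<close> makes dependent choice start at
    \<open>S0\<close>, where \<open>\<Gamma>\<close> is already refuted.\<close>
  have "\<exists>S. \<forall>n. (\<not> punfoc pol (S n) {#} \<and> (n = 0 \<longrightarrow> S n = S0)) \<and> S n \<subseteq> S (Suc n) \<and>
      (negative pol (N n) \<longrightarrow> \<not> pfoc pol (S n) (N n) \<longrightarrow> refuted pol (S (Suc n)) (N n))"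
  proof (rule dependent_nat_choice)
    show "\<exists>S. \<not> punfoc pol S {#} \<and> ((0 :: nat) = 0 \<longrightarrow> S = S0)"
      using S0 by blast
  next
    fix T and n :: nat
    assume "\<not> punfoc pol T {#} \<and> (n = 0 \<longrightarrow> T = S0)"
    then show "\<exists>T'. (\<not> punfoc pol T' {#} \<and> (Suc n = 0 \<longrightarrow> T' = S0)) \<and> T \<subseteq> T' \<and>
        (negative pol (N n) \<longrightarrow> \<not> pfoc pol T (N n) \<longrightarrow> refuted pol T' (N n))"
      using step[of T "N n"] by blast
  qed
  then obtain S where S: "\<And>n. \<not> punfoc pol (S n) {#}" "S 0 = S0" "\<And>n. S n \<subseteq> S (Suc n)"
    "\<And>n. negative pol (N n) \<Longrightarrow> \<not> pfoc pol (S n) (N n) \<Longrightarrow> refuted pol (S (Suc n)) (N n)"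
    by blast
  show thesis
  proof
    show "mono S" using S(3) by (simp add: mono_iff_le_Suc)
    show "\<not> punfoc pol (S n) {#}" for n by fact
    show "refuted pol (\<Union>n. S n) A" if "A \<in># \<Gamma>" for A
      using S0(2) that S(2) by (blast intro: refuted_mono)
    show "refuted pol (\<Union>n. S n) A"
      if A: "A \<in> L" "negative pol A" "\<And>n. \<not> pfoc pol (S n) A" for A
    proof -
      obtain n where "A = N n"
        using A(1) assms(2) from_nat_into_surj unfolding N_def by metis
      then show ?thesis
        using S(4)[of n] A by (blast intro: refuted_mono)
    qed
  qed
qed

lemma LKF_complete:
  fixes pol :: "'p \<Rightarrow> 'f tm list \<Rightarrow> polarity" and \<Gamma> :: "('f, 'p) fm multiset"
  assumes inf: "infinite (UNIV :: 'u set)" and valid: "valid_disj TYPE('u) \<Gamma>"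
  shows "unfoc pol {#} \<Gamma>"
proof (rule ccontr)
  assume "\<not> unfoc pol {#} \<Gamma>"
  then have unp: "\<not> punfoc pol {} \<Gamma>"
    by (auto simp: punfoc_def)
  define Fs where "Fs = (\<Union>A \<in> set_mset \<Gamma>. set1_fm A)"
  define Ps where "Ps = (\<Union>A \<in> set_mset \<Gamma>. set2_fm A)"
  have "countable Fs" "countable Ps"
    by (auto simp: Fs_def Ps_def intro!: countable_finite finite_symbols)
  define T where "T = tms_over Fs"
  define L where "L = fms_over Fs Ps"
  have "countable T" "countable L"
    using \<open>countable Fs\<close> \<open>countable Ps\<close>
    by (simp_all add: T_def L_def countable_tms_over countable_fms_over)
  obtain S :: "nat \<Rightarrow> ('f, 'p) fm set" where inc: "mono S" and unpS: "\<And>n. \<not> punfoc pol (S n) {#}"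
    and S\<Gamma>: "\<And>A. A \<in># \<Gamma> \<Longrightarrow> refuted pol (\<Union>n. S n) A"
    and SN: "\<And>N. N \<in> L \<Longrightarrow> negative pol N \<Longrightarrow> (\<And>n. \<not> pfoc pol (S n) N) \<Longrightarrow>
      refuted pol (\<Union>n. S n) N"
    using saturated_chain[OF unp \<open>countable L\<close>] by blast
  define U where "U = (\<Union>n. S n)"
  obtain g :: "nat \<Rightarrow> 'u" where "inj g"
    using infinite_countable_subset[OF inf] by blast
  \<comment> \<open>Terms are numbered and the numbers are embedded into \<open>'u\<close>, which
    places the term model in the given type.\<close>
  define enc where "enc = g \<circ> to_nat_on T"
  have inj: "inj_on enc T"
    unfolding enc_def using \<open>countable T\<close> \<open>inj g\<close>
    by (intro comp_inj_on inj_on_to_nat_on) (auto intro: inj_on_subset)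
  define dec where "dec = inv_into T enc"
  have dec_enc: "dec (enc t) = t" if "t \<in> T" for t
    using that inj by (simp add: dec_def)
  define D where "D = enc ` T"
  \<comment> \<open>A symbol outside \<open>Fs\<close> would lead out of \<open>T\<close>; the
    default \<open>Var 0\<close> keeps the domain closed.\<close>
  define F where "F = (\<lambda>f us. enc (if f \<in> Fs then Fn f (map dec us) else Var 0))"
  \<comment> \<open>Whatever the polarity of the atom, its negative literal is false exactly if it
    belongs to \<open>U\<close>.\<close>
  define R where "R = (\<lambda>p us. if pol p (map dec us) = Positive then NAtm p (map dec us) \<in> U
    else Atm p (map dec us) \<notin> U)"
  define e where "e = (\<lambda>n. enc (Var n))"
  have struct: "is_structure D F"
    unfolding is_structure_def
  proof (intro conjI allI impI)
    show "D \<noteq> {}"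
      by (auto simp: D_def T_def intro: Var_in_tms_over)
    fix f us assume "set us \<subseteq> D"
    then have "set (map dec us) \<subseteq> T"
      by (auto simp: D_def dec_enc)
    then show "F f us \<in> D"
      by (simp add: D_def F_def T_def)
  qed
  have e: "range e \<subseteq> D"
    by (auto simp: e_def D_def T_def)
  have eval: "eval F e t = enc t" if "t \<in> T" for t
    using that
  proof (induction t)
    case (Fn f ts)
    then have "map (dec \<circ> eval F e) ts = ts"
      by (intro map_idI) (auto simp: T_def dec_enc[unfolded T_def])
    then show ?case
      using Fn.prems by (simp add: F_def T_def)
  qed (simp add: e_def)
  have atom: "map (dec \<circ> eval F e) ts = ts" if "set ts \<subseteq> T" for ts
    using that by (intro map_idI) (auto simp: eval dec_enc)
  \<comment> \<open>Both claims go through one induction because each supports the other. For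
    positive formulas the second follows from the first, since a stored formula can be focused on;
    for negative formulas the first follows from the second by saturation.\<close>
  have false: "((\<forall>n. \<not> pfoc pol (S n) A) \<longrightarrow> \<not> sat D F R e A) \<and>
      (refuted pol U A \<longrightarrow> \<not> sat D F R e A)"
    if "A \<in> L" for A
    using that
  proof (induction A rule: measure_induct_rule[where f = cx])
    case (less A)
    show ?case
    proof (cases "positive pol A")
      case True
      have foc: "\<not> sat D F R e A" if nf: "\<And>n. \<not> pfoc pol (S n) A"
      proof (cases A)
        case (Atm p ts)
        then have "NAtm p ts \<notin> S n" for n
          using nf[of n] True pfoc_IdP[of pol p ts "S n"] by auto
        then have "NAtm p ts \<notin> U"
          by (simp add: U_def)
        then show ?thesis
          using Atm True less.prems by (simp add: R_def L_def atom[unfolded T_def])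
      next
        case (NAtm p ts)
        then have "Atm p ts \<notin> S n" for n
          using nf[of n] True pfoc_IdN[of pol p ts "S n"] by auto
        then have "Atm p ts \<notin> U"
          by (simp add: U_def)
        then show ?thesis
          using NAtm True less.prems by (simp add: R_def L_def atom[unfolded T_def])
      next
        case TT
        then show ?thesis using nf pfoc_TT by blast
      next
        case (ConP B C)
        \<comment> \<open>If both conjuncts became provable, possibly at different stages, both
          would be provable at the later one.\<close>
        have "(\<forall>n. \<not> pfoc pol (S n) B) \<or> (\<forall>n. \<not> pfoc pol (S n) C)"
        proof (rule ccontr)
          assume "\<not> ?thesis"
          then obtain m n where "pfoc pol (S m) B" "pfoc pol (S n) C" by blast
          then have "pfoc pol (S (max m n)) (ConP B C)"
            using inc by (intro pfoc_ConP) (simp_all add: pfoc_mono monoD)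
          then show False using nf ConP by blast
        qed
        then show ?thesis
          using less.IH[of B] less.IH[of C] less.prems ConP by (auto simp: L_def)
      next
        case (DisP B C)
        then show ?thesis
          using less.IH[of B] less.IH[of C] less.prems nf pfoc_DisP1 pfoc_DisP2
          by (fastforce simp: L_def)
      next
        case (Ex B)
        \<comment> \<open>Every element of the domain is the value of a term in \<open>T\<close>, so
          these instances cover all possible witnesses.\<close>
        have "\<not> sat D F R e (inst t B)" if "t \<in> T" for t
          using that less.IH[of "inst t B"] less.prems nf pfoc_Ex Ex
          by (fastforce simp: L_def T_def inst_in_fms_over)
        then show ?thesis
          using Ex by (auto simp: sat_inst eval D_def)
      qed (use True in auto)
      have "\<not> pfoc pol (S n) A" if "refuted pol U A" for n
      proof
        assume n: "pfoc pol (S n) A"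
        \<comment> \<open>A positive formula can be refuted only by being stored. At the later of
          the two stages it is both stored and provable under focus, so \<open>Focus\<close> would
          prove the sequent that the chain keeps unprovable.\<close>
        from that True have "A \<in> U" by cases auto
        then obtain m where "A \<in> S m" by (auto simp: U_def)
        then have "A \<in> S (max m n)" "pfoc pol (S (max m n)) A"
          using n monoD[OF inc, of m "max m n"] monoD[OF inc, of n "max m n"]
          by (auto elim!: pfoc_mono)
        then show False
          using True punfoc_Focus unpS by blast
      qed
      then show ?thesis
        using foc by blast
    next
      case False
      have "\<not> sat D F R e A" if "refuted pol U A"
        using that
      proof cases
        case stored
        \<comment> \<open>A stored negative formula is a literal, false by the choice of
          \<open>R\<close>.\<close>
        with False show ?thesis
          using less.prems
          by (cases A) (auto simp: storable_def R_def L_def atom[unfolded T_def]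
              intro: polarity.exhaust)
      next
        case (ConN1 B C)
        then show ?thesis using less.IH[of B] less.prems by (auto simp: L_def)
      next
        case (ConN2 C B)
        then show ?thesis using less.IH[of C] less.prems by (auto simp: L_def)
      next
        case (DisN B C)
        then show ?thesis using less.IH[of B] less.IH[of C] less.prems by (auto simp: L_def)
      next
        case (All x B)
        then have "\<not> sat D F R e (inst (Var x) B)"
          using less.IH[of "inst (Var x) B"] less.prems by (auto simp: L_def inst_in_fms_over)
        moreover have "eval F e (Var x) \<in> D"
          using struct e by (rule eval_in_structure)
        ultimately show ?thesis
          using All by (auto simp: sat_inst)
      qed simp
      then show ?thesis
        using SN[OF less.prems False] by (auto simp: U_def)
    qed
  qed
  have "A \<in> L" if "A \<in># \<Gamma>" for A
    using that by (auto simp: L_def fms_over_def Fs_def Ps_def)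
  then have "\<not> sat D F R e A" if "A \<in># \<Gamma>" for A
    using that false S\<Gamma> by (simp add: U_def)
  then show False
    using valid struct e unfolding valid_disj_def by blast
qed

theorem theorem2:
  fixes pol :: "'p \<Rightarrow> 'f tm list \<Rightarrow> polarity"
    and \<Gamma> :: "('f, 'p) fm multiset"
  assumes "infinite (UNIV :: 'u set)"
  shows "unfoc pol {#} \<Gamma> \<longleftrightarrow> valid_disj TYPE('u) \<Gamma>"
proof
  assume "unfoc pol {#} \<Gamma>"
  then show "valid_disj TYPE('u) \<Gamma>"
    unfolding valid_disj_def using LKF_sound(1)[of _ _ pol "{#}" \<Gamma>] by fastforce
qed (rule LKF_complete[OF assms])

end
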